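(* Let $\Gamma=(V,E)$ be a finite simple graph with $m=|V|$ vertices $v_1,\dots,v_m$, where $e_{ij}=e_{ji}$ denotes the edge joining $v_i$ and $v_j$. Let $\alpha$ be any map assigning to each edge $e_{ij}\in E$ a nonzero homogeneous linear polynomial $\alpha(e_{ij})\in\mathbb{C}[x,y]$. Put $$H_{\mathbb{T}}^{*}(\Gamma)=\Big\{(f_1,\dots,f_m)\in\bigoplus_{i=1}^{m}\mathbb{C}[x,y]\ :\ \alpha(e_{ij})\mid f_i-f_j\ \text{ for all } e_{ij}\in E\Big\}.$$ Then $H_{\mathbb{T}}^{*}(\Gamma)\cong(\mathbb{C}[x,y])^{m}$ as modules over $\mathbb{C}[x,y]$.
   Context: A simple graph is undirected, with no loops and no multiple edges. $\mathbb{C}[x,y]$ acts on $H_{\mathbb{T}}^{*}(\Gamma)$ componentwise: $g\cdot(f_1,\dots,f_m)=(gf_1,\dots,gf_m)$. No relation between $\alpha$ and any embedding of the graph is assumed. *)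

theory Defs
  imports Complex_Main "Jordan_Normal_Form.VS_Connect"
begin

text \<open>\<open>\<complex>[x,y]\<close> is realised as \<open>\<complex>[x][y]\<close>:
  the coefficient of \<open>x\<^sup>j y\<^sup>i\<close> in \<open>p\<close> is \<open>coeff (coeff p i) j\<close>.
  As a ring record it is \<open>class_ring\<close>.\<close>

type_synonym poly_xy = "complex poly poly"

definition homogeneous_xy :: "nat \<Rightarrow> poly_xy \<Rightarrow> bool" where
  "homogeneous_xy d p \<longleftrightarrow>
     (\<forall>i j. Polynomial.coeff (Polynomial.coeff p i) j \<noteq> 0 \<longrightarrow> i + j = d)"

text \<open>Edges are two-element sets of vertices, so loops, orientations and multiple edges
  are excluded and an edge labelling automatically satisfies \<open>\<alpha>(e\<^sub>i\<^sub>j) = \<alpha>(e\<^sub>j\<^sub>i)\<close>.\<close>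

definition finite_simple_graph :: "'v set \<Rightarrow> 'v set set \<Rightarrow> bool" where
  "finite_simple_graph V E \<longleftrightarrow> finite V \<and> (\<forall>e\<in>E. e \<subseteq> V \<and> card e = 2)"

text \<open>The module depends on a listing \<open>v 0, \<dots>, v (m - 1)\<close> of the vertices, since
  its elements are tuples indexed by positions. Addition and scalar
  multiplication are those of the ambient free module of \<open>m\<close>-tuples.\<close>

definition HT ::
  "nat \<Rightarrow> (nat \<Rightarrow> 'v) \<Rightarrow> 'v set set \<Rightarrow> ('v set \<Rightarrow> poly_xy) \<Rightarrow> (poly_xy, poly_xy vec) module" where
  "HT m v E \<alpha> = (module_vec TYPE(poly_xy) m)
     \<lparr>carrier := {f \<in> carrier_vec m.
        \<forall>i<m. \<forall>j<m. {v i, v j} \<in> E \<longrightarrow> \<alpha> {v i, v j} dvd f $ i - f $ j}\<rparr>"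

definition module_isomorphic ::
  "('r, 'x) ring_scheme \<Rightarrow> ('r, 'a, 'y) module_scheme \<Rightarrow> ('r, 'b, 'z) module_scheme \<Rightarrow> bool" where
  "module_isomorphic R M N \<longleftrightarrow>
     (\<exists>\<phi>. \<phi> \<in> LinearCombinations.module_hom R M N \<and> bij_betw \<phi> (carrier M) (carrier N))"

lemma module_module_vec:
  "Module.module (class_ring :: 'r :: comm_ring_1 ring) (module_vec TYPE('r) m)"
proof (rule moduleI)
  show "cring (class_ring :: 'r ring)" by (rule class_cring.cring_axioms)
  show "abelian_group (module_vec TYPE('r) m)"
  proof (rule abelian_groupI)
    fix x assume "x \<in> carrier (module_vec TYPE('r) m)"
    then show "\<exists>y\<in>carrier (module_vec TYPE('r) m).
        y \<oplus>\<^bsub>module_vec TYPE('r) m\<^esub> x = \<zero>\<^bsub>module_vec TYPE('r) m\<^esub>"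
      by (intro bexI[of _ "- x"]) (auto simp: module_vec_simps)
  qed (auto simp: module_vec_simps assoc_add_vec[of _ m] comm_add_vec[of _ m])
qed (auto simp: module_vec_simps smult_add_distrib_vec[of _ m] smult_smult_assoc
       add_smult_distrib_vec)

lemma module_HT: "Module.module class_ring (HT m v E \<alpha>)"
  unfolding HT_def
proof (rule Module.submodule.submodule_is_module[OF _ module_module_vec])
  interpret Module.module class_ring "module_vec TYPE(poly_xy) m" by (rule module_module_vec)
  let ?H = "{f \<in> carrier_vec m.
    \<forall>i<m. \<forall>j<m. {v i, v j} \<in> E \<longrightarrow> \<alpha> {v i, v j} dvd f $ i - f $ j}"
  have neg: "\<ominus>\<^bsub>module_vec TYPE(poly_xy) m\<^esub> a = - a" if "a \<in> carrier_vec m" for a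
    using that by (intro M.minus_equality) (auto simp: module_vec_simps)
  show "Module.submodule ?H class_ring (module_vec TYPE(poly_xy) m)"
  proof (rule submoduleI)
    fix a assume a: "a \<in> ?H"
    have "\<alpha> {v i, v j} dvd - (a $ i) - - (a $ j)"
      if "i < m" "j < m" "{v i, v j} \<in> E" for i j
    proof -
      have "\<alpha> {v i, v j} dvd - (a $ i - a $ j)"
        using a that by (simp only: dvd_minus_iff) auto
      then show ?thesis by simp
    qed
    with a show "\<ominus>\<^bsub>module_vec TYPE(poly_xy) m\<^esub> a \<in> ?H"
      by (auto simp: neg)
  next
    fix a b assume ab: "a \<in> ?H" "b \<in> ?H"
    have "\<alpha> {v i, v j} dvd (a $ i + b $ i) - (a $ j + b $ j)"
      if "i < m" "j < m" "{v i, v j} \<in> E" for i j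
    proof -
      have "\<alpha> {v i, v j} dvd (a $ i - a $ j) + (b $ i - b $ j)"
        using ab that by (intro dvd_add) auto
      then show ?thesis by (simp add: algebra_simps)
    qed
    with ab show "a \<oplus>\<^bsub>module_vec TYPE(poly_xy) m\<^esub> b \<in> ?H"
      by (auto simp: module_vec_simps)
  next
    fix g :: poly_xy and f assume f: "f \<in> ?H"
    have "\<alpha> {v i, v j} dvd g * f $ i - g * f $ j"
      if "i < m" "j < m" "{v i, v j} \<in> E" for i j
      using f that by (auto simp flip: right_diff_distrib)
    with f show "g \<odot>\<^bsub>module_vec TYPE(poly_xy) m\<^esub> f \<in> ?H"
      by (auto simp: module_vec_simps)
  qed (auto simp: module_vec_simps)
qed

end

theory Submission
  imports Defs
begin

text \<open>
  The module \<open>H\<close> of tuples is graded, because the labels are homogeneous, and the plan is to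
  exhibit \<open>m\<close> homogeneous elements that form a basis.

  Since \<open>\<complex>\<close> is infinite, there is a slope \<open>c\<close> such that no label vanishes on the line \<open>y = c x\<close>;
  let \<open>l = y - c x\<close>. Two facts about this line carry the proof. First, a homogeneous \<open>p\<close> of
  degree \<open>d\<close> restricts to \<open>p(1, c) x\<^sup>d\<close>, so it is divisible by \<open>l\<close> as soon as the single number
  \<open>p(1, c)\<close> vanishes (\<open>restrict_homogeneous_xy\<close>). Second, \<open>l\<close> can be cancelled in the
  divisibility conditions (\<open>dvd_slope_line_cancel\<close>), so a tuple \<open>l \<cdot> q\<close> lies in \<open>H\<close> only if \<open>q\<close>
  does. In the language of commutative algebra, \<open>l\<close> is a nonzerodivisor on the free module
  modulo \<open>H\<close>, and hence \<open>H / l H\<close> embeds into a free module over \<open>\<complex>[x]\<close>.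

  Call \<open>m\<close> homogeneous elements of \<open>H\<close> a frame if their values at \<open>(1, c)\<close> form a basis of \<open>\<complex>\<^sup>m\<close>.
  The product of all labels times the unit vectors is a frame. Choose a frame \<open>h\<close> whose
  degrees \<open>\<delta> k\<close> have the least possible sum. If \<open>f \<in> H\<close> is homogeneous of degree \<open>d\<close> and
  \<open>f(1, c) = \<Sum> a k h k(1, c)\<close>, then \<open>a k \<noteq> 0\<close> forces \<open>\<delta> k \<le> d\<close>: otherwise exchanging \<open>h k\<close> for
  \<open>f\<close> would give a frame of smaller degree (\<open>minimal_frame_slope_coordinates\<close>). Therefore
  \<open>f - \<Sum> a k x\<^bsup>d - \<delta> k\<^esup> h k\<close> is a homogeneous element of \<open>H\<close> that vanishes at \<open>(1, c)\<close>, so it equals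
  \<open>l \<cdot> q\<close> with \<open>q \<in> H\<close> homogeneous of degree \<open>d - 1\<close>. Induction on \<open>d\<close> shows that the frame
  generates \<open>H\<close> (\<open>homogeneous_generated\<close>, \<open>minimal_frame_generates\<close>). Its elements are independent
  because the determinant of the matrix with columns \<open>h k\<close> is nonzero already at \<open>(1, c)\<close>.
\<close>

section \<open>The grading of the polynomial ring\<close>

lemma poly_xy_eqI:
  fixes p q :: poly_xy
  assumes "\<And>i j. Polynomial.coeff (Polynomial.coeff p i) j = Polynomial.coeff (Polynomial.coeff q i) j"
  shows "p = q"
  using assms by (intro poly_eqI)

lemma homogeneous_xy_0 [simp]: "homogeneous_xy d 0"
  by (simp add: homogeneous_xy_def)

lemma homogeneous_xy_diff:
  assumes "homogeneous_xy d p" "homogeneous_xy d q"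
  shows "homogeneous_xy d (p - q)"
  unfolding homogeneous_xy_def
proof (intro allI impI)
  fix i j
  assume "Polynomial.coeff (Polynomial.coeff (p - q) i) j \<noteq> 0"
  then have "Polynomial.coeff (Polynomial.coeff p i) j \<noteq> 0 \<or>
      Polynomial.coeff (Polynomial.coeff q i) j \<noteq> 0"
    by auto
  with assms show "i + j = d"
    by (auto simp: homogeneous_xy_def)
qed

lemma homogeneous_xy_sum:
  assumes "\<And>k. k \<in> K \<Longrightarrow> homogeneous_xy d (f k)"
  shows "homogeneous_xy d (\<Sum>k\<in>K. f k)"
  unfolding homogeneous_xy_def
proof (intro allI impI)
  fix i j
  assume "Polynomial.coeff (Polynomial.coeff (\<Sum>k\<in>K. f k) i) j \<noteq> 0"
  then obtain k where "k \<in> K" "Polynomial.coeff (Polynomial.coeff (f k) i) j \<noteq> 0"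
    unfolding Polynomial.coeff_sum by (rule sum.not_neutral_contains_not_neutral)
  with assms show "i + j = d"
    unfolding homogeneous_xy_def by blast
qed

lemma homogeneous_xy_mult:
  assumes p: "homogeneous_xy d p" and q: "homogeneous_xy e q"
  shows "homogeneous_xy (d + e) (p * q)"
  unfolding homogeneous_xy_def
proof (intro allI impI)
  fix i j
  assume "Polynomial.coeff (Polynomial.coeff (p * q) i) j \<noteq> 0"
  then have "(\<Sum>k\<le>i. \<Sum>l\<le>j. Polynomial.coeff (Polynomial.coeff p k) l *
      Polynomial.coeff (Polynomial.coeff q (i - k)) (j - l)) \<noteq> 0"
    by (simp add: coeff_mult Polynomial.coeff_sum)
  then obtain k where k: "k \<in> {..i}" "(\<Sum>l\<le>j. Polynomial.coeff (Polynomial.coeff p k) l *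
      Polynomial.coeff (Polynomial.coeff q (i - k)) (j - l)) \<noteq> 0"
    by (rule sum.not_neutral_contains_not_neutral)
  from k(2) obtain l where l: "l \<in> {..j}" "Polynomial.coeff (Polynomial.coeff p k) l *
      Polynomial.coeff (Polynomial.coeff q (i - k)) (j - l) \<noteq> 0"
    by (rule sum.not_neutral_contains_not_neutral)
  with p q have "k + l = d" "i - k + (j - l) = e"
    by (auto simp: homogeneous_xy_def)
  with k l show "i + j = d + e" by simp
qed

lemma homogeneous_xy_prod:
  assumes "finite K" "\<And>k. k \<in> K \<Longrightarrow> \<exists>d. homogeneous_xy d (f k)"
  shows "\<exists>d. homogeneous_xy d (\<Prod>k\<in>K. f k)"
  using assms
proof (induction K rule: finite_induct)
  case empty
  have "homogeneous_xy 0 1"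
    by (auto simp: homogeneous_xy_def split: if_splits)
  then show ?case by auto
next
  case (insert k K)
  then obtain d e where "homogeneous_xy d (f k)" "homogeneous_xy e (\<Prod>k\<in>K. f k)"
    by blast
  then have "homogeneous_xy (d + e) (f k * (\<Prod>k\<in>K. f k))"
    by (rule homogeneous_xy_mult)
  with insert(1,2) show ?case
    by (intro exI[of _ "d + e"]) simp
qed

lemma homogeneous_xy_monom_x: "homogeneous_xy n [: Polynomial.monom a n :]"
  by (auto simp: homogeneous_xy_def coeff_pCons split: nat.splits if_splits)

text \<open>The truncated difference \<open>d - i\<close> is harmless: for \<open>i > d\<close> it is \<open>0\<close>, and the coefficient of
  \<open>x\<^sup>0 y\<^sup>i\<close> vanishes by homogeneity.\<close>

lemma coeff_homogeneous_xy:
  assumes "homogeneous_xy d p"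
  shows "Polynomial.coeff p i =
    Polynomial.monom (Polynomial.coeff (Polynomial.coeff p i) (d - i)) (d - i)"
proof (rule poly_eqI)
  fix j
  show "Polynomial.coeff (Polynomial.coeff p i) j = Polynomial.coeff
    (Polynomial.monom (Polynomial.coeff (Polynomial.coeff p i) (d - i)) (d - i)) j"
    using assms by (cases "Polynomial.coeff (Polynomial.coeff p i) j = 0")
      (force simp: homogeneous_xy_def)+
qed

definition homogeneous_part :: "nat \<Rightarrow> poly_xy \<Rightarrow> poly_xy" where
  "homogeneous_part d p = (\<Sum>i\<le>d. Polynomial.monom
     (Polynomial.monom (Polynomial.coeff (Polynomial.coeff p i) (d - i)) (d - i)) i)"

lemma coeff_homogeneous_part:
  "Polynomial.coeff (Polynomial.coeff (homogeneous_part d p) i) j =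
    (if i + j = d then Polynomial.coeff (Polynomial.coeff p i) j else 0)"
proof -
  have "Polynomial.coeff (homogeneous_part d p) i =
      (if i \<le> d then Polynomial.monom (Polynomial.coeff (Polynomial.coeff p i) (d - i)) (d - i) else 0)"
    by (simp add: homogeneous_part_def Polynomial.coeff_sum)
  then show ?thesis by auto
qed

lemma homogeneous_xy_part: "homogeneous_xy d (homogeneous_part d p)"
  by (auto simp: homogeneous_xy_def coeff_homogeneous_part split: if_splits)

lemma homogeneous_part_homogeneous:
  assumes "homogeneous_xy e p"
  shows "homogeneous_part d p = (if d = e then p else 0)"
  using assms by (intro poly_xy_eqI) (auto simp: coeff_homogeneous_part homogeneous_xy_def)

lemma homogeneous_part_diff:
  "homogeneous_part d (p - q) = homogeneous_part d p - homogeneous_part d q"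
  by (intro poly_xy_eqI) (auto simp: coeff_homogeneous_part)

lemma homogeneous_part_sum:
  "homogeneous_part d (\<Sum>k\<in>K. f k) = (\<Sum>k\<in>K. homogeneous_part d (f k))"
  by (intro poly_xy_eqI) (auto simp: coeff_homogeneous_part Polynomial.coeff_sum)

lemma sum_homogeneous_parts:
  "\<exists>N. \<forall>D\<ge>N. p = (\<Sum>d\<le>D. homogeneous_part d p)"
proof (intro exI allI impI poly_xy_eqI)
  define B where "B = Max ((\<lambda>i. degree (Polynomial.coeff p i)) ` {..degree p})"
  fix D i j
  assume D: "degree p + B \<le> D"
  have "Polynomial.coeff (Polynomial.coeff p i) j = 0" if "D < i + j"
  proof (cases "degree p < i")
    case True
    then show ?thesis by (simp add: coeff_eq_0)
  next
    case False
    then have "degree (Polynomial.coeff p i) \<le> B"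
      unfolding B_def by (intro Max_ge) auto
    with that D False show ?thesis by (intro coeff_eq_0) simp
  qed
  then show "Polynomial.coeff (Polynomial.coeff p i) j =
      Polynomial.coeff (Polynomial.coeff (\<Sum>d\<le>D. homogeneous_part d p) i) j"
    by (auto simp: Polynomial.coeff_sum coeff_homogeneous_part)
qed

text \<open>Multiplication by a homogeneous polynomial shifts the grading. This is what makes
  divisibility by a homogeneous label pass to homogeneous parts, so that the module of tuples
  is graded.\<close>

lemma homogeneous_part_mult:
  assumes a: "homogeneous_xy e a"
  shows "homogeneous_part d (a * q) = (if e \<le> d then a * homogeneous_part (d - e) q else 0)"
proof -
  obtain N where "\<forall>D\<ge>N. q = (\<Sum>k\<le>D. homogeneous_part k q)"
    using sum_homogeneous_parts by blast
  then have q: "q = (\<Sum>k\<le>N + d. homogeneous_part k q)"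
    by simp
  have "homogeneous_part d (a * q) = (\<Sum>k\<le>N + d. homogeneous_part d (a * homogeneous_part k q))"
    by (subst q) (simp add: sum_distrib_left homogeneous_part_sum)
  also have "\<dots> = (\<Sum>k\<le>N + d. if d = e + k then a * homogeneous_part k q else 0)"
    by (intro sum.cong refl homogeneous_part_homogeneous homogeneous_xy_mult a homogeneous_xy_part)
  also have "\<dots> = (\<Sum>k\<le>N + d. if k = d - e then if e \<le> d then a * homogeneous_part k q else 0 else 0)"
    by (intro sum.cong) auto
  also have "\<dots> = (if e \<le> d then a * homogeneous_part (d - e) q else 0)"
    by (simp only: sum.delta finite_atMost) auto
  finally show ?thesis .
qed

lemma homogeneous_xy_cofactor:
  assumes a: "homogeneous_xy e a" "a \<noteq> 0" and aq: "homogeneous_xy d (a * q)"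
  shows "homogeneous_xy (d - e) q" and "d < e \<Longrightarrow> q = 0"
proof -
  have "a * q = (if e \<le> d then a * homogeneous_part (d - e) q else 0)"
    using homogeneous_part_mult[OF a(1), of d q] homogeneous_part_homogeneous[OF aq, of d] by simp
  with a(2) have "q = (if e \<le> d then homogeneous_part (d - e) q else 0)"
    by (auto split: if_splits)
  moreover from this show "d < e \<Longrightarrow> q = 0"
    by simp
  ultimately show "homogeneous_xy (d - e) q"
    using homogeneous_xy_part[of "d - e" q] by (cases "e \<le> d") auto
qed


section \<open>Restriction to a line through the origin\<close>

text \<open>The value of \<open>p\<close> at the point \<open>(x, y) = (1, c)\<close>: the inner evaluation substitutes \<open>y = c x\<close>
  and leaves a polynomial in \<open>x\<close>.\<close>

definition slope_value :: "complex \<Rightarrow> poly_xy \<Rightarrow> complex" where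
  "slope_value c p = poly (poly p [:0, c:]) 1"

lemma comm_ring_hom_slope_value: "comm_ring_hom (slope_value c)"
  by unfold_locales (auto simp: slope_value_def)

text \<open>Each term \<open>b x\<^bsup>d - i\<^esup> y\<^sup>i\<close> becomes \<open>b c\<^sup>i x\<^sup>d\<close>. On homogeneous polynomials the number
  \<open>p(1, c)\<close> thus decides whether \<open>p\<close> vanishes on the whole line.\<close>

lemma restrict_homogeneous_xy:
  assumes p: "homogeneous_xy d p"
  shows "poly p [:0, c:] = Polynomial.monom (slope_value c p) d"
proof -
  let ?b = "\<lambda>i. Polynomial.coeff (Polynomial.coeff p i) (d - i)"
  have x: "[:0, c:] ^ i = Polynomial.monom (c ^ i) i" for i
  proof -
    have "[:0, c:] = Polynomial.monom c (Suc 0)"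
      by (simp add: monom_Suc monom_0)
    then show ?thesis by (simp add: monom_power)
  qed
  have summand: "Polynomial.coeff p i * [:0, c:] ^ i = Polynomial.monom (?b i * c ^ i) d" for i
  proof (cases "?b i = 0")
    case True
    then show ?thesis
      by (subst coeff_homogeneous_xy[OF p]) simp
  next
    case False
    with p have "i + (d - i) = d"
      by (auto simp: homogeneous_xy_def)
    then show ?thesis
      by (subst coeff_homogeneous_xy[OF p]) (simp add: x mult_monom add.commute)
  qed
  have "poly p [:0, c:] = (\<Sum>i\<le>degree p. Polynomial.monom (?b i * c ^ i) d)"
    by (simp only: poly_altdef summand)
  also have "\<dots> = Polynomial.monom (\<Sum>i\<le>degree p. ?b i * c ^ i) d"
    by (intro poly_eqI) (simp add: Polynomial.coeff_sum)
  finally show ?thesis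
    by (simp add: slope_value_def poly_monom)
qed

text \<open>Setting \<open>x = 1\<close> loses no information about a homogeneous polynomial, so \<open>p(1, y)\<close> is a nonzero
  polynomial in \<open>y\<close>, and the excluded slopes are its roots.\<close>

lemma finite_slope_zeros:
  assumes p: "homogeneous_xy d p" "p \<noteq> 0"
  shows "finite {c. slope_value c p = 0}"
proof -
  let ?q = "map_poly (\<lambda>r. poly r 1) p"
  have "poly ?q c = slope_value c p" for c
  proof -
    have "poly ?q c = (\<Sum>i\<le>degree p. Polynomial.coeff ?q i * c ^ i)"
      unfolding poly_altdef
      by (rule sum.mono_neutral_left) (auto simp: coeff_map_poly coeff_eq_0 intro!: degree_le)
    then show ?thesis
      by (simp add: slope_value_def poly_altdef[of p] poly_sum coeff_map_poly)
  qed
  moreover have "?q \<noteq> 0"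
  proof -
    have "Polynomial.coeff ?q (degree p) =
        Polynomial.coeff (Polynomial.coeff p (degree p)) (d - degree p)"
      by (subst coeff_map_poly, simp, subst coeff_homogeneous_xy[OF p(1)]) (simp add: poly_monom)
    also have "\<dots> \<noteq> 0"
      using p coeff_homogeneous_xy[OF p(1), of "degree p"] by auto
    finally show ?thesis by auto
  qed
  ultimately show ?thesis
    using poly_roots_finite[of ?q] by simp
qed

text \<open>The linear form \<open>y - c x\<close>.\<close>

definition slope_line :: "complex \<Rightarrow> poly_xy" where
  "slope_line c = [: - [:0, c:], 1 :]"

lemma homogeneous_xy_slope_line: "homogeneous_xy 1 (slope_line c)"
  by (auto simp: homogeneous_xy_def slope_line_def coeff_pCons split: nat.splits if_splits)

lemma slope_line_nonzero: "slope_line c \<noteq> 0"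
  by (simp add: slope_line_def)

lemma slope_line_dvd_iff: "slope_line c dvd p \<longleftrightarrow> poly p [:0, c:] = 0"
  unfolding slope_line_def by (rule poly_eq_0_iff_dvd[symmetric])

text \<open>If \<open>(y - c x) q = a r\<close>, then \<open>a r\<close> vanishes on the line while \<open>a\<close> does not, so \<open>r\<close> does.
  Hence \<open>y - c x\<close> divides \<open>r\<close> and cancels on both sides.\<close>

lemma dvd_slope_line_cancel:
  assumes a: "slope_value c a \<noteq> 0" and dvd: "a dvd slope_line c * q"
  shows "a dvd q"
proof -
  obtain r where r: "slope_line c * q = a * r"
    using dvd unfolding dvd_def by blast
  have "slope_line c dvd a * r"
    unfolding r[symmetric] by (rule dvd_triv_left)
  with a have "slope_line c dvd r"
    by (auto simp: slope_line_dvd_iff slope_value_def)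
  then obtain s where "r = slope_line c * s"
    unfolding dvd_def by blast
  with r have "slope_line c * q = slope_line c * (a * s)"
    by (simp only: mult.left_commute)
  then have "q = a * s"
    using slope_line_nonzero mult_cancel_left by blast
  then show ?thesis by simp
qed


section \<open>A frame of minimal degree\<close>

text \<open>The labels enter in two ways: homogeneity makes the module graded, and a nonzero value at
  \<open>(1, c)\<close> allows \<open>y - c x\<close> to be cancelled.\<close>

locale graph_labelling =
  fixes m :: nat and v :: "nat \<Rightarrow> 'v" and E :: "'v set set" and \<alpha> :: "'v set \<Rightarrow> poly_xy"
    and c :: complex
  assumes finite_edges: "finite E"
    and label_homogeneous: "\<And>e. e \<in> E \<Longrightarrow> \<exists>d. homogeneous_xy d (\<alpha> e)"
    and label_slope_value: "\<And>e. e \<in> E \<Longrightarrow> slope_value c (\<alpha> e) \<noteq> 0"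
begin

abbreviation H :: "poly_xy vec set" where
  "H \<equiv> carrier (HT m v E \<alpha>)"

lemma H_iff: "f \<in> H \<longleftrightarrow> f \<in> carrier_vec m \<and>
    (\<forall>i<m. \<forall>j<m. {v i, v j} \<in> E \<longrightarrow> \<alpha> {v i, v j} dvd f $ i - f $ j)"
  by (simp add: HT_def)

definition homogeneous_vec :: "nat \<Rightarrow> poly_xy vec \<Rightarrow> bool" where
  "homogeneous_vec d f \<longleftrightarrow> (\<forall>r<m. homogeneous_xy d (f $ r))"

definition col_matrix :: "(nat \<Rightarrow> poly_xy vec) \<Rightarrow> poly_xy mat" where
  "col_matrix h = mat m m (\<lambda>(r, k). h k $ r)"

text \<open>The determinant condition says that the values of the \<open>h k\<close> at \<open>(1, c)\<close> form a basis
  of \<open>\<complex>\<^sup>m\<close>; written with the polynomial determinant it also gives independence over \<open>\<complex>[x,y]\<close>.\<close>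

definition frame :: "(nat \<Rightarrow> poly_xy vec) \<Rightarrow> (nat \<Rightarrow> nat) \<Rightarrow> bool" where
  "frame h \<delta> \<longleftrightarrow> (\<forall>k<m. h k \<in> H \<and> homogeneous_vec (\<delta> k) (h k)) \<and>
     slope_value c (det (col_matrix h)) \<noteq> 0"

sublocale slope: comm_ring_hom "slope_value c"
  by (rule comm_ring_hom_slope_value)

lemma col_matrix_carrier [simp]: "col_matrix h \<in> carrier_mat m m"
  by (simp add: col_matrix_def)

lemma col_matrix_mult_vec [simp]:
  assumes "g \<in> carrier_vec m" "r < m"
  shows "(col_matrix h *\<^sub>v g) $ r = (\<Sum>k<m. h k $ r * g $ k)"
  using assms by (simp add: col_matrix_def scalar_prod_def lessThan_atLeast0)

lemma col_matrix_mult_smult_vec: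
  assumes "g \<in> carrier_vec m"
  shows "col_matrix h *\<^sub>v (p \<cdot>\<^sub>v g) = p \<cdot>\<^sub>v (col_matrix h *\<^sub>v g)"
proof (rule eq_vecI)
  fix r assume "r < dim_vec (p \<cdot>\<^sub>v (col_matrix h *\<^sub>v g))"
  then have "r < m" by (simp add: col_matrix_def)
  with assms carrier_vecD[OF mult_mat_vec_carrier[OF col_matrix_carrier assms, of h]]
  show "(col_matrix h *\<^sub>v (p \<cdot>\<^sub>v g)) $ r = (p \<cdot>\<^sub>v (col_matrix h *\<^sub>v g)) $ r"
    by (simp add: sum_distrib_left mult.left_commute del: dim_mult_mat_vec)
qed simp

lemma slope_matrix:
  "map_mat (slope_value c) (col_matrix h) = mat m m (\<lambda>(r, k). slope_value c (h k $ r))"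
  by (rule eq_matI) (auto simp: col_matrix_def)

lemma slope_det: "slope_value c (det (col_matrix h)) = det (mat m m (\<lambda>(r, k). slope_value c (h k $ r)))"
  by (simp add: slope.hom_det[symmetric] slope_matrix)

lemma col_matrix_mult_vec_in_H:
  assumes "\<And>k. k < m \<Longrightarrow> h k \<in> H" "g \<in> carrier_vec m"
  shows "col_matrix h *\<^sub>v g \<in> H"
  unfolding H_iff
proof (intro conjI allI impI)
  show "col_matrix h *\<^sub>v g \<in> carrier_vec m"
    using assms(2) by (intro mult_mat_vec_carrier[of _ m m]) auto
next
  fix i j
  assume ij: "i < m" "j < m" "{v i, v j} \<in> E"
  have "(col_matrix h *\<^sub>v g) $ i - (col_matrix h *\<^sub>v g) $ j =
      (\<Sum>k<m. (h k $ i - h k $ j) * g $ k)"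
    using assms(2) ij by (simp add: sum_subtractf left_diff_distrib)
  also have "\<alpha> {v i, v j} dvd \<dots>"
    using assms(1) ij by (intro dvd_sum dvd_mult2) (auto simp: H_iff)
  finally show "\<alpha> {v i, v j} dvd (col_matrix h *\<^sub>v g) $ i - (col_matrix h *\<^sub>v g) $ j" .
qed

text \<open>A tuple all of whose entries are divisible by every label satisfies all conditions
  trivially; the product of the labels does not vanish at \<open>(1, c)\<close>.\<close>

lemma frame_exists: "\<exists>h \<delta>. frame h \<delta>"
proof -
  define P where "P = (\<Prod>e\<in>E. \<alpha> e)"
  obtain d where d: "homogeneous_xy d P"
    unfolding P_def using homogeneous_xy_prod[OF finite_edges, of \<alpha>] label_homogeneous by blast
  have "frame (\<lambda>k. P \<cdot>\<^sub>v unit_vec m k) (\<lambda>_. d)"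
    unfolding frame_def
  proof (intro conjI allI impI)
    fix k assume "k < m"
    have "\<alpha> e dvd P" if "e \<in> E" for e
      unfolding P_def using finite_edges that by (rule dvd_prodI)
    then show "P \<cdot>\<^sub>v unit_vec m k \<in> H"
      by (auto simp: H_iff right_diff_distrib[symmetric])
    show "homogeneous_vec d (P \<cdot>\<^sub>v unit_vec m k)"
      using d by (auto simp: homogeneous_vec_def unit_vec_def)
  next
    have "col_matrix (\<lambda>k. P \<cdot>\<^sub>v unit_vec m k) = P \<cdot>\<^sub>m 1\<^sub>m m"
      by (rule eq_matI) (auto simp: col_matrix_def)
    then show "slope_value c (det (col_matrix (\<lambda>k. P \<cdot>\<^sub>v unit_vec m k))) \<noteq> 0"
      using label_slope_value finite_edges
      by (simp add: P_def slope.hom_power slope.hom_prod)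
  qed
  then show ?thesis by blast
qed

definition minimal_frame :: "(nat \<Rightarrow> poly_xy vec) \<Rightarrow> (nat \<Rightarrow> nat) \<Rightarrow> bool" where
  "minimal_frame h \<delta> \<longleftrightarrow> frame h \<delta> \<and>
     (\<forall>h' \<delta>'. frame h' \<delta>' \<longrightarrow> (\<Sum>k<m. \<delta> k) \<le> (\<Sum>k<m. \<delta>' k))"

lemma minimal_frame_exists: "\<exists>h \<delta>. minimal_frame h \<delta>"
proof -
  have "\<exists>x. case_prod frame x"
    using frame_exists by auto
  then obtain x where "case_prod frame x"
      "\<forall>y. case_prod frame y \<longrightarrow> (\<Sum>k<m. snd x k) \<le> (\<Sum>k<m. snd y k)"
    using ex_has_least_nat[of "case_prod frame" _ "\<lambda>x. \<Sum>k<m. snd x k"] by blast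
  then show ?thesis
    by (intro exI[of _ "fst x"] exI[of _ "snd x"]) (auto simp: minimal_frame_def split: prod.splits)
qed

text \<open>The coordinates \<open>a\<close> of \<open>f(1, c)\<close> exist because the frame is a basis at \<open>(1, c)\<close>. By Cramer's rule,
  replacing \<open>h k\<close> by \<open>f\<close> multiplies the determinant by \<open>a k\<close>; if \<open>a k \<noteq> 0\<close> this is again a
  frame, and minimality compares \<open>\<delta> k\<close> with \<open>d\<close>.\<close>

lemma minimal_frame_slope_coordinates:
  assumes min: "minimal_frame h \<delta>" and f: "f \<in> H" "homogeneous_vec d f"
  obtains a where "\<And>r. r < m \<Longrightarrow> slope_value c (f $ r) = (\<Sum>k<m. slope_value c (h k $ r) * a k)"
    and "\<And>k. k < m \<Longrightarrow> a k \<noteq> 0 \<Longrightarrow> \<delta> k \<le> d"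
proof -
  define W where "W = mat m m (\<lambda>(r, k). slope_value c (h k $ r))"
  define w where "w = vec m (\<lambda>r. slope_value c (f $ r))"
  define a where "a = (1 / det W) \<cdot>\<^sub>v (adj_mat W *\<^sub>v w)"
  have W: "W \<in> carrier_mat m m" and w: "w \<in> carrier_vec m"
    by (simp_all add: W_def w_def)
  have det: "det W \<noteq> 0"
    using min by (simp add: minimal_frame_def frame_def slope_det W_def)
  note adj = adj_mat[OF W]
  have a: "a \<in> carrier_vec m"
    unfolding a_def using adj w by auto
  have Wa: "W *\<^sub>v a = w"
  proof -
    have "W *\<^sub>v a = (1 / det W) \<cdot>\<^sub>v (W *\<^sub>v (adj_mat W *\<^sub>v w))"
      unfolding a_def using W adj w by (intro mult_mat_vec) auto
    also have "W *\<^sub>v (adj_mat W *\<^sub>v w) = (W * adj_mat W) *\<^sub>v w"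
      using W adj w by (intro assoc_mult_mat_vec[symmetric]) auto
    also have "\<dots> = det W \<cdot>\<^sub>v w"
      using w unfolding adj(2) by (intro eq_vecI) auto
    finally show ?thesis
      using det w by (simp add: smult_smult_assoc)
  qed
  show ?thesis
  proof (rule that[of "\<lambda>k. a $ k"])
    fix r assume r: "r < m"
    have "slope_value c (f $ r) = (W *\<^sub>v a) $ r"
      using r by (simp add: Wa w_def)
    also have "\<dots> = (\<Sum>k<m. slope_value c (h k $ r) * a $ k)"
      using r a by (simp add: W_def scalar_prod_def lessThan_atLeast0)
    finally show "slope_value c (f $ r) = (\<Sum>k<m. slope_value c (h k $ r) * a $ k)" .
  next
    fix k assume k: "k < m" "a $ k \<noteq> 0"
    have "mat m m (\<lambda>(r, l). slope_value c ((h(k := f)) l $ r)) = replace_col W w k"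
      by (rule eq_matI) (auto simp: replace_col_def W_def w_def)
    then have "det (mat m m (\<lambda>(r, l). slope_value c ((h(k := f)) l $ r))) = a $ k * det W"
      using cramer_lemma_mat[OF W a k(1)] by (simp add: Wa)
    then have "frame (h(k := f)) (\<delta>(k := d))"
      using min f k det by (auto simp: frame_def minimal_frame_def slope_det)
    then have "(\<Sum>l<m. \<delta> l) \<le> (\<Sum>l<m. (\<delta>(k := d)) l)"
      using min unfolding minimal_frame_def by blast
    moreover have "(\<Sum>l\<in>{..<m} - {k}. (\<delta>(k := d)) l) = (\<Sum>l\<in>{..<m} - {k}. \<delta> l)"
      by (intro sum.cong) auto
    ultimately show "\<delta> k \<le> d"
      using k by (simp add: sum.remove[of "{..<m}" k] del: fun_upd_apply) simp
  qed
qed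


section \<open>A minimal frame is a basis\<close>

lemma frame_injective:
  assumes "frame h \<delta>"
  shows "inj_on (\<lambda>g. col_matrix h *\<^sub>v g) (carrier_vec m)"
proof (rule inj_onI)
  fix g g' :: "poly_xy vec"
  assume g: "g \<in> carrier_vec m" "g' \<in> carrier_vec m"
    and eq: "col_matrix h *\<^sub>v g = col_matrix h *\<^sub>v g'"
  have "det (col_matrix h) \<noteq> 0"
    using assms by (auto simp: frame_def)
  moreover have "col_matrix h *\<^sub>v (g - g') = 0\<^sub>v m"
    using g eq by (subst mult_minus_distrib_mat_vec[of _ m m])
      (auto intro!: minus_cancel_vec mult_mat_vec_carrier[of _ m m])
  ultimately have "g - g' = 0\<^sub>v m"
    using det_0_iff_vec_prod_zero[OF col_matrix_carrier] minus_carrier_vec[OF g] by blast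
  then have "(g - g') $ k = 0" if "k < m" for k
    using that by simp
  then show "g = g'"
    using g by (intro eq_vecI) auto
qed

text \<open>A combination of the frame is subtracted that has the same value at \<open>(1, c)\<close>. It exists in
  degree \<open>d\<close> because only frame elements of degree at most \<open>d\<close> occur. The difference is \<open>y - c x\<close>
  times an element of \<open>H\<close> of degree \<open>d - 1\<close>, to which induction applies; for \<open>d = 0\<close> it is zero.\<close>

lemma homogeneous_generated:
  assumes min: "minimal_frame h \<delta>" and "f \<in> H" "homogeneous_vec d f"
  shows "\<exists>g \<in> carrier_vec m. col_matrix h *\<^sub>v g = f"
  using assms(2,3)
proof (induction d arbitrary: f rule: less_induct)
  case (less d)
  have frame: "h k \<in> H" "homogeneous_vec (\<delta> k) (h k)" if "k < m" for k
    using min that by (auto simp: minimal_frame_def frame_def)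
  obtain a where a: "\<And>r. r < m \<Longrightarrow> slope_value c (f $ r) = (\<Sum>k<m. slope_value c (h k $ r) * a k)"
    and deg: "\<And>k. k < m \<Longrightarrow> a k \<noteq> 0 \<Longrightarrow> \<delta> k \<le> d"
    using minimal_frame_slope_coordinates[OF min less.prems] by blast
  (* For a k = 0 the exponent may be a truncated difference, but then the entry is 0. *)
  define g where "g = vec m (\<lambda>k. [: Polynomial.monom (a k) (d - \<delta> k) :])"
  define f' where "f' = f - col_matrix h *\<^sub>v g"
  have f: "f \<in> carrier_vec m" and g: "g \<in> carrier_vec m"
    using less.prems by (auto simp: H_iff g_def)
  have hg: "col_matrix h *\<^sub>v g \<in> H"
    using frame g by (intro col_matrix_mult_vec_in_H) auto
  have hgv: "col_matrix h *\<^sub>v g \<in> carrier_vec m"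
    using hg unfolding H_iff by blast
  have f'_nth: "f' $ r = f $ r - (\<Sum>k<m. h k $ r * g $ k)" if "r < m" for r
    using that f g carrier_vecD[OF hgv] by (simp add: f'_def del: dim_mult_mat_vec)
  have f': "f' \<in> H"
    unfolding H_iff
  proof (intro conjI allI impI)
    show "f' \<in> carrier_vec m"
      using f hg by (auto simp: f'_def H_iff)
    fix i j
    assume ij: "i < m" "j < m" "{v i, v j} \<in> E"
    have "f' $ i - f' $ j =
        (f $ i - f $ j) - ((col_matrix h *\<^sub>v g) $ i - (col_matrix h *\<^sub>v g) $ j)"
      using ij f g by (simp add: f'_nth)
    also have "\<alpha> {v i, v j} dvd \<dots>"
      using less.prems(1) hg ij unfolding H_iff by (intro dvd_diff[of _ "f $ i - f $ j"]) auto
    finally show "\<alpha> {v i, v j} dvd f' $ i - f' $ j" .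
  qed
  have f'_hom: "homogeneous_xy d (f' $ r)" if r: "r < m" for r
  proof -
    have "homogeneous_xy d (h k $ r * g $ k)" if k: "k < m" for k
    proof (cases "a k = 0")
      case True
      with k show ?thesis by (simp add: g_def)
    next
      case False
      have "homogeneous_xy (\<delta> k + (d - \<delta> k)) (h k $ r * g $ k)"
        using k r frame(2)[OF k]
        by (intro homogeneous_xy_mult) (simp_all add: homogeneous_vec_def g_def homogeneous_xy_monom_x)
      with deg[OF k False] show ?thesis by simp
    qed
    with r less.prems(2) show ?thesis
      unfolding f'_nth[OF r] homogeneous_vec_def
      by (intro homogeneous_xy_diff homogeneous_xy_sum) auto
  qed
  have "\<exists>q. f' $ r = slope_line c * q" if r: "r < m" for r
  proof -
    have "slope_value c (h k $ r * g $ k) = slope_value c (h k $ r) * a k" if "k < m" for k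
      using that by (simp add: slope_value_def g_def poly_monom)
    then have "slope_value c (f' $ r) = 0"
      using r by (simp add: f'_nth a slope.hom_minus slope.hom_sum)
    then have "slope_line c dvd f' $ r"
      using restrict_homogeneous_xy[OF f'_hom[OF r]] by (simp add: slope_line_dvd_iff)
    then show ?thesis
      unfolding dvd_def .
  qed
  then obtain Q where Q: "\<And>r. r < m \<Longrightarrow> f' $ r = slope_line c * Q r"
    by metis
  define q where "q = vec m Q"
  have q: "q \<in> H"
    unfolding H_iff
  proof (intro conjI allI impI)
    show "q \<in> carrier_vec m" by (simp add: q_def)
    fix i j
    assume ij: "i < m" "j < m" "{v i, v j} \<in> E"
    then have "\<alpha> {v i, v j} dvd f' $ i - f' $ j"
      using f' by (simp add: H_iff)
    then have "\<alpha> {v i, v j} dvd slope_line c * (q $ i - q $ j)"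
      using ij by (simp add: Q q_def right_diff_distrib)
    then show "\<alpha> {v i, v j} dvd q $ i - q $ j"
      using label_slope_value[OF ij(3)] dvd_slope_line_cancel by blast
  qed
  have Q_hom: "homogeneous_xy (d - 1) (Q r)" "d < 1 \<Longrightarrow> Q r = 0" if "r < m" for r
    using homogeneous_xy_cofactor[OF homogeneous_xy_slope_line slope_line_nonzero] f'_hom[OF that]
    by (simp_all add: Q[OF that])
  have "\<exists>g' \<in> carrier_vec m. col_matrix h *\<^sub>v g' = q"
  proof (cases "d = 0")
    case True
    then have "col_matrix h *\<^sub>v 0\<^sub>v m = q"
      using Q_hom by (intro eq_vecI) (auto simp: q_def col_matrix_def)
    then show ?thesis by (intro bexI[of _ "0\<^sub>v m"]) auto
  next
    case False
    then show ?thesis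
      using q Q_hom(1) by (intro less.IH[of "d - 1"]) (auto simp: homogeneous_vec_def q_def)
  qed
  then obtain g' where g': "g' \<in> carrier_vec m" "col_matrix h *\<^sub>v g' = q"
    by blast
  have "col_matrix h *\<^sub>v (g + slope_line c \<cdot>\<^sub>v g') = f"
  proof -
    have "col_matrix h *\<^sub>v (g + slope_line c \<cdot>\<^sub>v g') =
        col_matrix h *\<^sub>v g + slope_line c \<cdot>\<^sub>v q"
      using g g' by (simp add: mult_add_distrib_mat_vec[of _ m m] col_matrix_mult_smult_vec)
    also have "slope_line c \<cdot>\<^sub>v q = f'"
      using f' by (intro eq_vecI) (auto simp: q_def Q H_iff)
    also have "col_matrix h *\<^sub>v g + f' = f"
      using f carrier_vecD[OF hgv] by (intro eq_vecI) (auto simp: f'_def simp del: dim_mult_mat_vec)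
    finally show ?thesis .
  qed
  with g g' show ?case
    by (intro bexI[of _ "g + slope_line c \<cdot>\<^sub>v g'"]) auto
qed

lemma homogeneous_part_in_H:
  assumes "f \<in> H"
  shows "vec m (\<lambda>r. homogeneous_part d (f $ r)) \<in> H"
  unfolding H_iff
proof (intro conjI allI impI)
  fix i j
  assume ij: "i < m" "j < m" "{v i, v j} \<in> E"
  then obtain q where "f $ i - f $ j = \<alpha> {v i, v j} * q"
    using assms unfolding H_iff dvd_def by blast
  moreover obtain e where "homogeneous_xy e (\<alpha> {v i, v j})"
    using label_homogeneous[OF ij(3)] by blast
  ultimately have "\<alpha> {v i, v j} dvd homogeneous_part d (f $ i - f $ j)"
    by (simp add: homogeneous_part_mult)
  then show "\<alpha> {v i, v j} dvd vec m (\<lambda>r. homogeneous_part d (f $ r)) $ i -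
      vec m (\<lambda>r. homogeneous_part d (f $ r)) $ j"
    using ij by (simp add: homogeneous_part_diff)
qed simp

lemma minimal_frame_generates:
  assumes min: "minimal_frame h \<delta>" and f: "f \<in> H"
  shows "\<exists>g \<in> carrier_vec m. col_matrix h *\<^sub>v g = f"
proof -
  have "\<forall>d. \<exists>g \<in> carrier_vec m. col_matrix h *\<^sub>v g = vec m (\<lambda>r. homogeneous_part d (f $ r))"
  proof
    fix d
    show "\<exists>g \<in> carrier_vec m. col_matrix h *\<^sub>v g = vec m (\<lambda>r. homogeneous_part d (f $ r))"
      by (rule homogeneous_generated[OF min homogeneous_part_in_H[OF f], of d])
        (simp add: homogeneous_vec_def homogeneous_xy_part)
  qed
  then obtain G where G: "\<And>d. G d \<in> carrier_vec m"
      "\<And>d. col_matrix h *\<^sub>v G d = vec m (\<lambda>r. homogeneous_part d (f $ r))"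
    by metis
  have "\<forall>r. \<exists>N. \<forall>D\<ge>N. f $ r = (\<Sum>d\<le>D. homogeneous_part d (f $ r))"
    using sum_homogeneous_parts by (intro allI)
  from choice[OF this] obtain N
    where N: "\<And>r D. N r \<le> D \<Longrightarrow> f $ r = (\<Sum>d\<le>D. homogeneous_part d (f $ r))"
    by blast
  (* A sum instead of a maximum: any common upper bound of the N r serves. *)
  define D where "D = (\<Sum>r<m. N r)"
  define g where "g = vec m (\<lambda>k. \<Sum>d\<le>D. G d $ k)"
  have "col_matrix h *\<^sub>v g = f"
  proof (rule eq_vecI)
    show "dim_vec (col_matrix h *\<^sub>v g) = dim_vec f"
      using f by (auto simp: H_iff col_matrix_def)
    fix r assume "r < dim_vec f"
    then have r: "r < m"
      using f by (auto simp: H_iff)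
    then have "N r \<le> D"
      unfolding D_def by (intro member_le_sum) auto
    have "(col_matrix h *\<^sub>v g) $ r = (\<Sum>k<m. \<Sum>d\<le>D. h k $ r * G d $ k)"
      using r by (simp add: g_def sum_distrib_left)
    also have "\<dots> = (\<Sum>d\<le>D. (col_matrix h *\<^sub>v G d) $ r)"
      using r G(1) by (subst sum.swap) simp
    also have "\<dots> = f $ r"
      using N[OF \<open>N r \<le> D\<close>, symmetric] r by (simp add: G(2))
    finally show "(col_matrix h *\<^sub>v g) $ r = f $ r" .
  qed
  then show ?thesis by (intro bexI[of _ g]) (auto simp: g_def)
qed

lemma HT_free:
  "module_isomorphic class_ring (module_vec TYPE(poly_xy) m) (HT m v E \<alpha>)"
proof -
  obtain h \<delta> where min: "minimal_frame h \<delta>"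
    using minimal_frame_exists by blast
  then have frame: "frame h \<delta>"
    by (simp add: minimal_frame_def)
  let ?\<phi> = "\<lambda>g. col_matrix h *\<^sub>v g"
  have into: "?\<phi> g \<in> H" if "g \<in> carrier_vec m" for g
    using frame that by (intro col_matrix_mult_vec_in_H) (auto simp: frame_def)
  have "?\<phi> \<in> LinearCombinations.module_hom class_ring (module_vec TYPE(poly_xy) m) (HT m v E \<alpha>)"
    using into by (auto simp: LinearCombinations.module_hom_def module_vec_simps HT_def
        intro!: mult_add_distrib_mat_vec[of _ m m] col_matrix_mult_smult_vec)
  moreover have "bij_betw ?\<phi> (carrier (module_vec TYPE(poly_xy) m)) H"
    unfolding module_vec_simps
  proof (rule bij_betw_imageI[OF frame_injective[OF frame]], rule equalityI)
    show "?\<phi> ` carrier_vec m \<subseteq> H"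
      using into by (rule image_subsetI)
    show "H \<subseteq> ?\<phi> ` carrier_vec m"
      using minimal_frame_generates[OF min] by blast
  qed
  ultimately show ?thesis
    unfolding module_isomorphic_def by blast
qed

end


section \<open>Freeness\<close>

lemma module_isomorphic_sym:
  assumes N: "Module.module R N" and iso: "module_isomorphic R N M"
  shows "module_isomorphic R M N"
proof -
  interpret N: Module.module R N by (rule N)
  obtain \<phi> where hom: "\<phi> \<in> LinearCombinations.module_hom R N M"
    and bij: "bij_betw \<phi> (carrier N) (carrier M)"
    using iso by (auto simp: module_isomorphic_def)
  let ?\<psi> = "inv_into (carrier N) \<phi>"
  have inv: "?\<psi> y \<in> carrier N" "\<phi> (?\<psi> y) = y" if "y \<in> carrier M" for y
    using bij that by (auto simp: bij_betw_def inv_into_into f_inv_into_f)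
  have inv': "?\<psi> (\<phi> x) = x" if "x \<in> carrier N" for x
    using bij that by (auto simp: bij_betw_def)
  have "?\<psi> (y \<oplus>\<^bsub>M\<^esub> z) = ?\<psi> y \<oplus>\<^bsub>N\<^esub> ?\<psi> z"
    if "y \<in> carrier M" "z \<in> carrier M" for y z
  proof -
    have "y \<oplus>\<^bsub>M\<^esub> z = \<phi> (?\<psi> y \<oplus>\<^bsub>N\<^esub> ?\<psi> z)"
      using hom inv that by (simp add: LinearCombinations.module_hom_def)
    then show ?thesis using inv' inv that by simp
  qed
  moreover have "?\<psi> (r \<odot>\<^bsub>M\<^esub> y) = r \<odot>\<^bsub>N\<^esub> ?\<psi> y"
    if "r \<in> carrier R" "y \<in> carrier M" for r y
  proof -
    have "r \<odot>\<^bsub>M\<^esub> y = \<phi> (r \<odot>\<^bsub>N\<^esub> ?\<psi> y)"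
      using hom inv that by (simp add: LinearCombinations.module_hom_def)
    then show ?thesis using inv' inv that by simp
  qed
  ultimately have "?\<psi> \<in> LinearCombinations.module_hom R M N"
    using inv by (auto simp: LinearCombinations.module_hom_def)
  with bij_betw_inv_into[OF bij] show ?thesis
    unfolding module_isomorphic_def by blast
qed

theorem theorem2p1:
  fixes V :: "'v set" and E :: "'v set set" and m :: nat
    and v :: "nat \<Rightarrow> 'v" and \<alpha> :: "'v set \<Rightarrow> poly_xy"
  assumes "finite_simple_graph V E"
    and "m = card V"
    and "bij_betw v {..<m} V"
    and "\<And>e. e \<in> E \<Longrightarrow> \<alpha> e \<noteq> 0 \<and> homogeneous_xy 1 (\<alpha> e)"
  shows "module_isomorphic class_ring (HT m v E \<alpha>) (module_vec TYPE(poly_xy) m)"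
proof -
  have "finite (Pow V)" "E \<subseteq> Pow V"
    using assms(1) by (auto simp: finite_simple_graph_def)
  then have fin: "finite E"
    by (rule finite_subset[rotated])
  have "finite (\<Union>e\<in>E. {c. slope_value c (\<alpha> e) = 0})"
    using fin assms(4) finite_slope_zeros by blast
  then obtain c where "c \<notin> (\<Union>e\<in>E. {c. slope_value c (\<alpha> e) = 0})"
    using ex_new_if_finite[OF infinite_UNIV_char_0] by blast
  then interpret graph_labelling m v E \<alpha> c
    using fin assms(4) by unfold_locales blast+
  show ?thesis
    by (rule module_isomorphic_sym[OF module_module_vec HT_free])
qed

end
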